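(* Let $X$ be a real linear space, $C\subseteq X$ a convex subset, $f:C\to\mathbb{R}$ a non-negative function, and $h:J\to\mathbb{R}$ a non-negative function. For $x,y\in C$ define $f_{x,y}:[0,1]\to\mathbb{R}$ by $f_{x,y}(t)=f(tx+(1-t)y)$. Then the following statements are equivalent: (i) $f$ is an $h$-convex function on $C$. (ii) For all $x,y\in C$, the mapping $f_{x,y}$ is an $h$-convex function on $[0,1]$.
   Context: $J\subseteq\mathbb{R}$ is an interval containing $[0,1]$, and $h:J\to\mathbb{R}$ is non-negative and not identically zero. A non-negative function $g:D\to\mathbb{R}$ on a convex subset $D$ of a real linear space is called $h$-convex on $D$ if $g(tx+(1-t)y)\le h(t)g(x)+h(1-t)g(y)$ for all $x,y\in D$ and all $t\in[0,1]$. *)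

theory Defs
  imports "HOL-Analysis.Analysis"
begin

text \<open>
  Functions on a subset of a type are rendered as total functions; only the values on the intended
  domain matter: \<open>D\<close> for \<open>g\<close>, and (as \<open>t\<close> and \<open>1 - t\<close> stay in \<open>[0,1]\<close>) the unit interval for \<open>h\<close>.
\<close>

definition h_convex_on :: "(real \<Rightarrow> real) \<Rightarrow> 'a::real_vector set \<Rightarrow> ('a \<Rightarrow> real) \<Rightarrow> bool" where
  "h_convex_on h D g \<longleftrightarrow>
     convex D \<and> (\<forall>x\<in>D. 0 \<le> g x) \<and>
     (\<forall>x\<in>D. \<forall>y\<in>D. \<forall>t\<in>{0..1}.
        g (t *\<^sub>R x + (1 - t) *\<^sub>R y) \<le> h t * g x + h (1 - t) * g y)"

definition segment_map :: "('a::real_vector \<Rightarrow> real) \<Rightarrow> 'a \<Rightarrow> 'a \<Rightarrow> real \<Rightarrow> real" where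
  "segment_map f x y t = f (t *\<^sub>R x + (1 - t) *\<^sub>R y)"

end

theory Submission
  imports Defs
begin

text \<open>The map \<open>segment_map f x y\<close> is f composed with the affine path s \<mapsto>
  s x + (1 - s) y, which carries [0,1] into the convex set C. Affine maps preserve convex
  combinations, so h-convexity of f passes to the composite
  (\<open>h_convex_on_segment_map\<close>). Conversely, the path runs from y at 0 to x at 1, so
  h-convexity of the composite at the two endpoints alone already gives the inequality for f at x
  and y.\<close>

lemma h_convex_on_segment_map:
  assumes "h_convex_on h C f" and x: "x \<in> C" and y: "y \<in> C"
  shows "h_convex_on h {0..1} (segment_map f x y)"
proof -
  define p where "p s = s *\<^sub>R x + (1 - s) *\<^sub>R y" for s :: real
  have C: "convex C" and pos: "\<And>z. z \<in> C \<Longrightarrow> 0 \<le> f z"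
    and hc: "\<And>u v t. u \<in> C \<Longrightarrow> v \<in> C \<Longrightarrow> t \<in> {0..1} \<Longrightarrow>
      f (t *\<^sub>R u + (1 - t) *\<^sub>R v) \<le> h t * f u + h (1 - t) * f v"
    using assms(1) by (auto simp: h_convex_on_def)
  have p_in: "p s \<in> C" if "s \<in> {0..1}" for s
    using convexD[OF C x y, of s "1 - s"] that by (simp add: p_def)
  \<comment> \<open>Since p s = y + s (x - y) and the weights t and 1 - t sum to 1, the constant
    term y is reproduced.\<close>
  have p_affine: "p (t * a + (1 - t) * b) = t *\<^sub>R p a + (1 - t) *\<^sub>R p b" for t a b
    by (simp add: p_def algebra_simps)
  have map_eq: "segment_map f x y s = f (p s)" for s
    by (simp add: segment_map_def p_def)
  show ?thesis
    unfolding h_convex_on_def map_eq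
    using p_in pos hc by (simp add: p_affine)
qed

theorem theorem3p1:
  fixes C :: "'a::real_vector set" and f :: "'a \<Rightarrow> real"
    and J :: "real set" and h :: "real \<Rightarrow> real"
  assumes "is_interval J" and "{0..1} \<subseteq> J"
    and "\<forall>t\<in>J. 0 \<le> h t" and "\<exists>t\<in>J. h t \<noteq> 0"
    and "convex C" and "\<forall>x\<in>C. 0 \<le> f x"
  shows "h_convex_on h C f \<longleftrightarrow> (\<forall>x\<in>C. \<forall>y\<in>C. h_convex_on h {0..1} (segment_map f x y))"
proof
  assume "h_convex_on h C f"
  then show "\<forall>x\<in>C. \<forall>y\<in>C. h_convex_on h {0..1} (segment_map f x y)"
    by (simp add: h_convex_on_segment_map)
next
  assume seg: "\<forall>x\<in>C. \<forall>y\<in>C. h_convex_on h {0..1} (segment_map f x y)"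
  have "f (t *\<^sub>R x + (1 - t) *\<^sub>R y) \<le> h t * f x + h (1 - t) * f y"
    if "x \<in> C" "y \<in> C" "t \<in> {0..1}" for x y t
  proof -
    \<comment> \<open>The points 1 and 0 are chosen because the path sends them to x and y, while
      their combination with weights t and 1 - t is t itself.\<close>
    have "segment_map f x y (t *\<^sub>R 1 + (1 - t) *\<^sub>R 0)
        \<le> h t * segment_map f x y 1 + h (1 - t) * segment_map f x y 0"
      using seg that unfolding h_convex_on_def
      by (meson atLeastAtMost_iff order_refl zero_le_one)
    then show ?thesis by (simp add: segment_map_def)
  qed
  then show "h_convex_on h C f"
    using assms(5,6) by (simp add: h_convex_on_def)
qed

end
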